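(* Let $1<q\le 2$, $0<\sigma\le 1$, $0<\nu\le 1$, let $n\ge 1$ be an integer, let $0<\xi<\eta_1<\eta_2<\dots<\eta_n<1$, and let $\alpha_i,\beta_i,\gamma_i\in\mathbb{R}$ ($i=1,\dots,n$). Set $$\Delta_1=\xi^{1-\sigma}\Gamma(2-\nu)-\Gamma(2-\sigma)\sum_{i=1}^n\alpha_i\eta_i^{1-\nu},\qquad \Delta_2=1-\sum_{i=1}^n(\beta_i\eta_i+\gamma_i),\qquad \Delta_3=-2+\sum_{i=1}^n\eta_i(\beta_i\eta_i+2\gamma_i),$$ and assume $\Delta_1\ne 0$ and $\Delta_2\ne 0$. Let $g:[0,1]\to\mathbb{R}^+=[0,\infty)$ be continuous and such that the constant $$\begin{aligned}\Phi={}&\Big(1+\frac{1}{|\Delta_2|}\Big)\int_0^1\frac{(1-s)^{q-1}}{\Gamma(q)}g(s)\,ds+\frac{1}{|\Delta_2|}\sum_{i=1}^n\int_0^{\eta_i}\frac{(\eta_i-s)^{q-1}}{\Gamma(q+1)}\big(q|\gamma_i|+|\beta_i|(\eta_i-s)\big)g(s)\,ds\\&+\frac{\Gamma(2-\sigma)\Gamma(2-\nu)\big(|\Delta_3|+2|\Delta_2|\big)}{2|\Delta_1\Delta_2|}\Big(\int_0^{\xi}\frac{(\xi-s)^{q-\sigma-1}}{\Gamma(q-\sigma)}g(s)\,ds+\sum_{i=1}^n|\alpha_i|\int_0^{\eta_i}\frac{(\eta_i-s)^{q-\nu-1}}{\Gamma(q-\nu)}g(s)\,ds\Big)\end{aligned}$$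 is positive. Let $f:[0,1]\times\mathbb{R}\to\mathbb{R}$ be a continuous function satisfying $$|f(t,x)-f(t,y)|\le g(t)\,\Phi^{-1}\ln(1+|x-y|)\quad\text{for all } t\in[0,1],\ x,y\in\mathbb{R}.$$ Then the boundary value problem $${}^{c}D^{q}x(t)=f(t,x(t)),\quad t\in[0,1],$$ $${}^{c}D^{\sigma}x(\xi)=\sum_{i=1}^n\alpha_i\,{}^{c}D^{\nu}x(\eta_i),\qquad x(1)=\sum_{i=1}^n\beta_i\int_0^{\eta_i}x(s)\,ds+\sum_{i=1}^n\gamma_i x(\eta_i)$$ has a unique solution on $[0,1]$.
   Context: $\Gamma$ is the Gamma function. For $\mu>0$ and a continuous function $u$ on $[0,1]$, the Riemann-Liouville fractional integral is $I^{\mu}u(t)=\frac{1}{\Gamma(\mu)}\int_0^t (t-s)^{\mu-1}u(s)\,ds$; put $I^0u=u$. ${}^{c}D^{\mu}$ denotes the Caputo fractional derivative of order $\mu$. For $\mu\in(0,1]$ and $x\in C^1[0,1]$, ${}^{c}D^{\mu}x=I^{1-\mu}x'$ (so ${}^{c}D^1x=x'$). For $q\in(1,2]$ and $x\in C^1[0,1]$ such that $z(t):=I^{2-q}\big[x(\cdot)-x(0)-x'(0)\,\cdot\,\big](t)$ belongs to $C^2[0,1]$, ${}^{c}D^{q}x=z''$ (this equals $I^{2-q}x''$ when $x\in C^2[0,1]$, and equals $x''$ when $q=2$). A solution of the boundary value problem is a real function $x\in C^1[0,1]$ for which ${}^{c}D^qx$ exists in this sense, which satisfies the differential equation for all $t\in[0,1]$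 and the two boundary conditions. *)

theory Defs
  imports "HOL-Analysis.Analysis"
begin

text \<open>
  Functions on the unit interval are total functions of type \<open>real \<Rightarrow> real\<close> of which only the
  values on \<open>{0..1}\<close> matter. Accordingly all derivatives are taken within \<open>{0..1}\<close>, so they
  are one-sided at the endpoints.
\<close>

definition deriv01 :: "(real \<Rightarrow> real) \<Rightarrow> real \<Rightarrow> real" where
  "deriv01 x t = vector_derivative x (at t within {0..1})"

definition C1_01 :: "(real \<Rightarrow> real) \<Rightarrow> bool" where
  "C1_01 x \<longleftrightarrow>
     (\<forall>t\<in>{0..1}. x differentiable (at t within {0..1})) \<and> continuous_on {0..1} (deriv01 x)"

definition C2_01 :: "(real \<Rightarrow> real) \<Rightarrow> bool" where
  "C2_01 x \<longleftrightarrow> C1_01 x \<and> C1_01 (deriv01 x)"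

definition RL_integral :: "real \<Rightarrow> (real \<Rightarrow> real) \<Rightarrow> real \<Rightarrow> real" where
  "RL_integral \<mu> u t =
     (if \<mu> = 0 then u t
      else 1 / Gamma \<mu> * integral {0..t} (\<lambda>s. (t - s) powr (\<mu> - 1) * u s))"

definition caputo_remainder :: "real \<Rightarrow> (real \<Rightarrow> real) \<Rightarrow> real \<Rightarrow> real" where
  "caputo_remainder q x = RL_integral (2 - q) (\<lambda>s. x s - x 0 - deriv01 x 0 * s)"

text \<open>
  Only orders in \<open>(0,2]\<close> are meaningful. The predicate \<open>has_caputo\<close> states that the
  derivative exists; where it fails, the value of \<open>caputo\<close> is irrelevant.
\<close>

definition has_caputo :: "real \<Rightarrow> (real \<Rightarrow> real) \<Rightarrow> bool" where
  "has_caputo \<mu> x \<longleftrightarrow> C1_01 x \<and> (1 < \<mu> \<longrightarrow> C2_01 (caputo_remainder \<mu> x))"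

definition caputo :: "real \<Rightarrow> (real \<Rightarrow> real) \<Rightarrow> real \<Rightarrow> real" where
  "caputo \<mu> x =
     (if \<mu> \<le> 1 then RL_integral (1 - \<mu>) (deriv01 x)
      else deriv01 (deriv01 (caputo_remainder \<mu> x)))"

definition bvp_solution ::
  "real \<Rightarrow> real \<Rightarrow> real \<Rightarrow> nat \<Rightarrow> real \<Rightarrow> (nat \<Rightarrow> real) \<Rightarrow> (nat \<Rightarrow> real) \<Rightarrow> (nat \<Rightarrow> real) \<Rightarrow>
   (nat \<Rightarrow> real) \<Rightarrow> (real \<Rightarrow> real \<Rightarrow> real) \<Rightarrow> (real \<Rightarrow> real) \<Rightarrow> bool" where
  "bvp_solution q \<sigma> \<nu> n \<xi> \<eta> \<alpha> \<beta> \<gamma> f x \<longleftrightarrow>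
     C1_01 x \<and> has_caputo q x \<and>
     (\<forall>t\<in>{0..1}. caputo q x t = f t (x t)) \<and>
     caputo \<sigma> x \<xi> = (\<Sum>i=1..n. \<alpha> i * caputo \<nu> x (\<eta> i)) \<and>
     x 1 = (\<Sum>i=1..n. \<beta> i * integral {0..\<eta> i} x) + (\<Sum>i=1..n. \<gamma> i * x (\<eta> i))"

end

theory Submission
  imports Defs
begin

text \<open>
  Weierstrass approximation reduces the continuity and the semigroup law of the Riemann-Liouville
  integrals to monomials, where they follow from the Beta integral. Hence \<open>x\<close> has Caputo derivative
  \<open>h\<close> of order \<open>q\<close> iff \<open>x t = RL_integral q h t + c\<^sub>0 + c\<^sub>1 * t\<close> on \<open>{0..1}\<close>, and the boundary
  conditions form a triangular linear system for \<open>c\<^sub>1\<close> and \<open>c\<^sub>0\<close> with diagonal \<open>\<Delta>\<^sub>1\<close>, \<open>\<Delta>\<^sub>2\<close>. The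
  boundary value problem thus becomes a fixed point equation in the supremum norm, and \<open>\<Phi>\<close> is
  exactly the constant for which distances \<open>r\<close> are mapped to distances at most \<open>ln (1 + r) < r\<close>.
  For such a comparison function, once a step \<open>dist (X N) (X (Suc N))\<close> of the Picard iteration is
  below \<open>r - ln (1 + r)\<close>, the ball of radius \<open>r\<close> around \<open>X N\<close> is invariant, so the iteration
  converges.
\<close>

subsection \<open>Riemann-Liouville integrals of continuous functions\<close>

text \<open>Substituting \<open>s = t * r\<close> in the Beta integral contributes one factor
  \<open>t\<close>; homogeneity of the integrand contributes the remaining
  \<open>t powr (p + a - 1)\<close>.\<close>

lemma has_integral_RL_kernel_powr:
  fixes a p t :: real
  assumes "0 < a" "-1 < p" "0 < t"
  shows "((\<lambda>s. (t - s) powr (a - 1) * s powr p) has_integral Beta (p + 1) a * t powr (p + a)) {0..t}"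
proof -
  have "((\<lambda>s. s powr p * (1 - s) powr (a - 1)) has_integral Beta (p + 1) a) (cbox 0 1)"
    using has_integral_Beta_real[of "p + 1" a] assms by simp
  from has_integral_affinity'[OF this, of "1 / t" 0] assms
  have "((\<lambda>s. (s / t) powr p * (1 - s / t) powr (a - 1)) has_integral t * Beta (p + 1) a) {0..t}"
    by (simp add: field_simps)
  from has_integral_mult_right[OF this, of "t powr (p + a - 1)"]
  have "((\<lambda>s. t powr (p + a - 1) * ((s / t) powr p * (1 - s / t) powr (a - 1)))
      has_integral Beta (p + 1) a * t powr (p + a)) {0..t}"
    using assms by (simp add: powr_mult_base mult_ac powr_diff)
  moreover have "t powr (p + a - 1) * ((s / t) powr p * (1 - s / t) powr (a - 1))
      = (t - s) powr (a - 1) * s powr p" if "s \<in> {0..t}" for s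
  proof -
    have "t powr (p + a - 1) = t powr p * t powr (a - 1)"
      using assms by (simp flip: powr_add add: add_diff_eq)
    moreover have "1 - s / t = (t - s) / t"
      using assms by (simp add: diff_divide_distrib)
    ultimately show ?thesis
      using that assms by (simp add: powr_divide)
  qed
  ultimately show ?thesis
    by (rule has_integral_eq[rotated])
qed

lemma RL_integral_0 [simp]: "RL_integral 0 u t = u t"
  by (simp add: RL_integral_def)

lemma RL_integral_at_0: "0 < a \<Longrightarrow> RL_integral a u 0 = 0"
  by (simp add: RL_integral_def)

lemma RL_integral_cong:
  assumes "0 \<le> t" "\<And>s. s \<in> {0..t} \<Longrightarrow> u s = v s"
  shows "RL_integral a u t = RL_integral a v t"
  using assms by (auto simp: RL_integral_def intro!: integral_cong)

lemma RL_integral_powr: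
  assumes "0 < a" "-1 < p" "0 \<le> t"
  shows "RL_integral a (\<lambda>s. s powr p) t = Gamma (p + 1) / Gamma (p + 1 + a) * t powr (p + a)"
proof (cases "t = 0")
  case False
  with assms have "integral {0..t} (\<lambda>s. (t - s) powr (a - 1) * s powr p) = Beta (p + 1) a * t powr (p + a)"
    by (intro integral_unique has_integral_RL_kernel_powr) auto
  moreover have "Gamma a \<noteq> 0" using assms Gamma_real_pos[of a] by linarith
  ultimately show ?thesis using assms
    by (simp add: RL_integral_def Beta_def)
qed (use assms in \<open>simp add: RL_integral_at_0\<close>)

lemma RL_integral_power:
  assumes "0 < a" "0 \<le> t"
  shows "RL_integral a (\<lambda>s. s ^ k) t = Gamma (real k + 1) / Gamma (real k + 1 + a) * t powr (real k + a)"
proof -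
  \<comment> \<open>The two integrands can differ at \<open>s = 0\<close> only, for
    \<open>0 ^ 0 = 1\<close> whereas \<open>0 powr 0 = 0\<close>.\<close>
  have "integral {0..t} (\<lambda>s. (t - s) powr (a - 1) * s ^ k)
      = integral {0..t} (\<lambda>s. (t - s) powr (a - 1) * s powr real k)"
    by (rule integral_spike[of "{0}"]) (auto simp: powr_realpow)
  then have "RL_integral a (\<lambda>s. s ^ k) t = RL_integral a (\<lambda>s. s powr real k) t"
    using assms by (simp add: RL_integral_def)
  then show ?thesis
    using RL_integral_powr[of a "real k" t] assms by simp
qed

section \<open>Integrability, linearity and positivity\<close>

lemma RL_kernel_absolutely_integrable:
  fixes a t :: real
  assumes "0 < a" "0 \<le> t"
  shows "(\<lambda>s. (t - s) powr (a - 1)) absolutely_integrable_on {0..t}"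
proof (cases "t = 0")
  case False
  have "(\<lambda>s. (t - s) powr (a - 1) * s powr 0) integrable_on {0..t}"
    using has_integral_RL_kernel_powr[of a 0 t] assms False by (auto simp: integrable_on_def)
  then have "(\<lambda>s. (t - s) powr (a - 1)) integrable_on {0..t}"
    by (rule integrable_spike[of _ _ "{0}"]) auto
  then show ?thesis
    by (rule nonnegative_absolutely_integrable_1) auto
next
  case True
  then show ?thesis
    using absolutely_integrable_continuous_real[of 0 0 "\<lambda>s. (t - s) powr (a - 1)"] by simp
qed

text \<open>For \<open>a < 1\<close> the kernel is unbounded near \<open>s = t\<close>, so the
  integrand need not be continuous. The kernel is absolutely integrable, however, and this survives
  multiplication by \<open>u\<close>, which is bounded and measurable.\<close>

lemma RL_integrand_integrable:
  fixes a t :: real and u :: "real \<Rightarrow> real"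
  assumes "0 < a" "0 \<le> t" "continuous_on {0..t} u"
  shows "(\<lambda>s. (t - s) powr (a - 1) * u s) integrable_on {0..t}"
proof -
  have "(\<lambda>s. u s * (t - s) powr (a - 1)) absolutely_integrable_on {0..t}"
  proof (rule absolutely_integrable_bounded_measurable_product_real)
    show "u \<in> borel_measurable (lebesgue_on {0..t})"
      using assms by (intro continuous_imp_measurable_on_sets_lebesgue) auto
    show "bounded (u ` {0..t})"
      using assms by (intro compact_imp_bounded compact_continuous_image) auto
  qed (use assms RL_kernel_absolutely_integrable in auto)
  from set_lebesgue_integral_eq_integral(1)[OF this] show ?thesis
    by (simp add: mult.commute)
qed

lemma RL_integral_add:
  assumes "0 \<le> a" "0 \<le> t" "continuous_on {0..t} u" "continuous_on {0..t} v"
  shows "RL_integral a (\<lambda>s. u s + v s) t = RL_integral a u t + RL_integral a v t"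
  using assms RL_integrand_integrable[of a t u] RL_integrand_integrable[of a t v]
  by (cases "a = 0") (auto simp: RL_integral_def integral_add distrib_left)

lemma RL_integral_cmult: "RL_integral a (\<lambda>s. c * u s) t = c * RL_integral a u t"
  by (simp add: RL_integral_def mult.left_commute[of _ c])

lemma RL_integral_diff:
  assumes "0 \<le> a" "0 \<le> t" "continuous_on {0..t} u" "continuous_on {0..t} v"
  shows "RL_integral a (\<lambda>s. u s - v s) t = RL_integral a u t - RL_integral a v t"
  using RL_integral_add[OF assms(1-3), of "\<lambda>s. (-1) * v s"] assms
  by (simp only: RL_integral_cmult continuous_intros) simp

lemma RL_integral_sum:
  assumes "0 \<le> a" "0 \<le> t" "finite I" "\<And>i. i \<in> I \<Longrightarrow> continuous_on {0..t} (u i)"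
  shows "RL_integral a (\<lambda>s. \<Sum>i\<in>I. c i * u i s) t = (\<Sum>i\<in>I. c i * RL_integral a (u i) t)"
  using assms(3,4)
proof induction
  case empty
  then show ?case by (simp add: RL_integral_def)
next
  case (insert i I)
  have "RL_integral a (\<lambda>s. c i * u i s + (\<Sum>i\<in>I. c i * u i s)) t
      = RL_integral a (\<lambda>s. c i * u i s) t + RL_integral a (\<lambda>s. \<Sum>i\<in>I. c i * u i s) t"
    using assms insert.prems by (intro RL_integral_add continuous_intros) auto
  then show ?case using insert
    by (simp add: RL_integral_cmult)
qed

lemma RL_integral_nonneg:
  assumes "0 \<le> a" "0 \<le> t" "\<And>s. s \<in> {0..t} \<Longrightarrow> 0 \<le> u s" "continuous_on {0..t} u"
  shows "0 \<le> RL_integral a u t"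
proof (cases "a = 0")
  case False
  then have "0 < Gamma a" using assms by (simp add: Gamma_real_pos)
  moreover have "0 \<le> integral {0..t} (\<lambda>s. (t - s) powr (a - 1) * u s)"
    using assms False by (intro integral_nonneg RL_integrand_integrable) auto
  ultimately show ?thesis using False by (simp add: RL_integral_def)
qed (use assms in auto)

lemma RL_integral_mono:
  assumes "0 \<le> a" "0 \<le> t" "\<And>s. s \<in> {0..t} \<Longrightarrow> u s \<le> v s"
    "continuous_on {0..t} u" "continuous_on {0..t} v"
  shows "RL_integral a u t \<le> RL_integral a v t"
  using RL_integral_nonneg[of a t "\<lambda>s. v s - u s"] RL_integral_diff[of a t v u] assms
  by (simp add: continuous_on_diff)

lemma RL_integral_abs_le:
  assumes "0 \<le> a" "0 \<le> t" "\<And>s. s \<in> {0..t} \<Longrightarrow> \<bar>u s\<bar> \<le> v s"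
    "continuous_on {0..t} u" "continuous_on {0..t} v"
  shows "\<bar>RL_integral a u t\<bar> \<le> RL_integral a v t"
proof -
  have "RL_integral a u t \<le> RL_integral a v t"
    using assms by (intro RL_integral_mono) (auto simp: abs_le_iff)
  moreover have "RL_integral a (\<lambda>s. (-1) * u s) t \<le> RL_integral a v t"
    using assms by (intro RL_integral_mono) (auto simp: abs_le_iff intro!: continuous_intros)
  ultimately show ?thesis
    unfolding RL_integral_cmult by auto
qed

text \<open>A constant \<open>M\<close> has the integral
  \<open>M * t powr a / Gamma (a + 1)\<close>, and \<open>t powr a\<close> is at most 1 here. As a
  sup norm estimate for the operator, this carries uniform approximations of \<open>u\<close> over
  to its fractional integral.\<close>

lemma RL_integral_const_bound:
  assumes "0 < a" "t \<in> {0..1}" "\<And>s. s \<in> {0..t} \<Longrightarrow> \<bar>u s\<bar> \<le> M" "continuous_on {0..t} u"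
  shows "\<bar>RL_integral a u t\<bar> \<le> M / Gamma (a + 1)"
proof -
  have M: "0 \<le> M" using assms(3)[of 0] assms(2) by auto
  \<comment> \<open>The constant is written with \<open>s ^ 0\<close> so that the formula for
    monomials applies with \<open>k = 0\<close>.\<close>
  have "\<bar>RL_integral a u t\<bar> \<le> RL_integral a (\<lambda>s. M * s ^ 0) t"
    using assms by (intro RL_integral_abs_le) auto
  also have "\<dots> = M * (1 / Gamma (a + 1) * t powr a)"
    unfolding RL_integral_cmult using RL_integral_power[of a t 0] assms by (simp add: add_ac)
  also have "\<dots> \<le> M * (1 / Gamma (a + 1) * 1)"
    using assms M by (intro mult_left_mono powr_le1) (auto simp: Gamma_real_pos less_imp_le)
  finally show ?thesis by simp
qed

section \<open>Continuity and the semigroup law by polynomial approximation\<close>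

lemma polynomial_approx_01:
  fixes u :: "real \<Rightarrow> real"
  assumes "continuous_on {0..1} u" "0 < e"
  obtains c n where "\<And>s. s \<in> {0..1} \<Longrightarrow> \<bar>u s - (\<Sum>i\<le>n. c i * s ^ i)\<bar> < e"
proof -
  obtain p where p: "real_polynomial_function p" "\<And>s. s \<in> {0..1} \<Longrightarrow> \<bar>u s - p s\<bar> < e"
    using Stone_Weierstrass_real_polynomial_function[OF _ assms(1,2)] by auto
  then obtain c n where "p = (\<lambda>x. \<Sum>i\<le>n. c i * x ^ i)"
    by (auto simp: real_polynomial_function_iff_sum)
  with p that show thesis by auto
qed

lemma RL_integral_polynomial:
  assumes "0 < a" "0 \<le> t"
  shows "RL_integral a (\<lambda>s. \<Sum>i\<le>n. c i * s ^ i) t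
    = (\<Sum>i\<le>n. c i * (Gamma (real i + 1) / Gamma (real i + 1 + a)) * t powr (real i + a))"
  using assms
  by (simp add: RL_integral_sum RL_integral_power continuous_on_power mult.assoc)

text \<open>The integral of a polynomial is a combination of the powers
  \<open>t powr (real i + a)\<close>, continuous up to 0 because the exponents are positive. The sup
  norm estimate makes the general case a uniform limit of these.\<close>

lemma continuous_on_RL_integral:
  assumes "0 \<le> a" "continuous_on {0..1} u"
  shows "continuous_on {0..1} (RL_integral a u)"
proof (cases "a = 0")
  case True
  then have "RL_integral a u = u" by (auto simp: fun_eq_iff)
  then show ?thesis using assms by simp
next
  case False
  with assms have a: "0 < a" by simp
  have G: "0 < Gamma (a + 1)" using a by (simp add: Gamma_real_pos)
  have "\<exists>h. continuous_on {0..1} h \<and> (\<forall>t\<in>{0..1}. dist (h t) (RL_integral a u t) < e)"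
    if "0 < e" for e :: real
  proof -
    \<comment> \<open>With this tolerance the estimate for the integrated error becomes
      \<open>e / 2\<close>, which leaves room for a strict inequality.\<close>
    from that have "0 < e * Gamma (a + 1) / 2" using G by simp
    then obtain c n where p: "\<And>s. s \<in> {0..1} \<Longrightarrow> \<bar>u s - (\<Sum>i\<le>n. c i * s ^ i)\<bar> < e * Gamma (a + 1) / 2"
      using polynomial_approx_01[OF assms(2)] by blast
    let ?p = "\<lambda>s. \<Sum>i\<le>n. c i * s ^ i"
    have "continuous_on {0..1} (RL_integral a ?p)"
    proof (rule continuous_on_eq)
      show "continuous_on {0..1} (\<lambda>t. \<Sum>i\<le>n. c i * (Gamma (real i + 1) / Gamma (real i + 1 + a)) * t powr (real i + a))"
        using a by (intro continuous_intros continuous_on_powr') (auto intro!: add_nonneg_pos)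
    qed (use RL_integral_polynomial a in auto)
    moreover have "dist (RL_integral a ?p t) (RL_integral a u t) < e" if "t \<in> {0..1}" for t
    proof -
      have c: "continuous_on {0..t} u" "continuous_on {0..t} ?p"
        using assms that by (auto intro!: continuous_intros elim: continuous_on_subset)
      have "\<bar>RL_integral a (\<lambda>s. u s - ?p s) t\<bar> \<le> (e * Gamma (a + 1) / 2) / Gamma (a + 1)"
        using a that c p by (intro RL_integral_const_bound) (auto intro!: continuous_on_diff less_imp_le)
      then have "\<bar>RL_integral a (\<lambda>s. u s - ?p s) t\<bar> \<le> e / 2" using G by simp
      then show ?thesis using RL_integral_diff[OF assms(1) _ c] \<open>t \<in> {0..1}\<close> \<open>0 < e\<close>
        by (simp add: dist_real_def abs_minus_commute)
    qed
    ultimately show "\<exists>h. continuous_on {0..1} h \<and> (\<forall>t\<in>{0..1}. dist (h t) (RL_integral a u t) < e)"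
      by blast
  qed
  then have "\<exists>h. continuous_on {0..1} h \<and> (\<forall>t\<in>{0..1}. dist (h t) (RL_integral a u t) < inverse (real (Suc n)))" for n
    by simp
  then obtain h where h: "\<And>n. continuous_on {0..1} (h n)"
    "\<And>n t. t \<in> {0..1} \<Longrightarrow> dist (h n t) (RL_integral a u t) < inverse (real (Suc n))"
    by metis
  show ?thesis
  proof (rule uniform_limit_theorem)
    show "uniform_limit {0..1} h (RL_integral a u) sequentially"
    proof (rule uniform_limitI)
      fix e :: real assume "0 < e"
      with order_tendstoD(2)[OF LIMSEQ_inverse_real_of_nat]
      have "\<forall>\<^sub>F n in sequentially. inverse (real (Suc n)) < e" by blast
      then show "\<forall>\<^sub>F n in sequentially. \<forall>t\<in>{0..1}. dist (h n t) (RL_integral a u t) < e"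
        by eventually_elim (use h(2) less_trans in blast)
    qed
  qed (use h in auto)
qed

lemma continuous_on_subset_01:
  "continuous_on {0..1} (u :: real \<Rightarrow> real) \<Longrightarrow> t \<in> {0..1} \<Longrightarrow> continuous_on {0..t} u"
  by (auto elim: continuous_on_subset)

text \<open>On monomials the Gamma quotients telescope; both sides are bounded linear in
  \<open>u\<close> for the sup norm, so polynomials suffice. No exchange of the order of integration
  is involved.\<close>

lemma RL_integral_semigroup:
  assumes "0 \<le> a" "0 \<le> b" "continuous_on {0..1} u" "t \<in> {0..1}"
  shows "RL_integral a (RL_integral b u) t = RL_integral (a + b) u t"
proof (cases "a = 0 \<or> b = 0")
  case True
  have "RL_integral 0 u = u" by (auto simp: fun_eq_iff)
  with True show ?thesis by auto
next
  case False
  with assms have ab: "0 < a" "0 < b" by auto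
  \<comment> \<open>\<open>K\<close> adds the sup norm bounds of the two operators; an approximation
    of \<open>u\<close> up to \<open>e / K\<close> then costs at most \<open>e\<close>.\<close>
  define K where "K = 1 / Gamma (b + 1) / Gamma (a + 1) + 1 / Gamma (a + b + 1)"
  have K: "0 < K" unfolding K_def using ab by (intro add_pos_pos divide_pos_pos Gamma_real_pos) auto
  have "\<bar>RL_integral a (RL_integral b u) t - RL_integral (a + b) u t\<bar> \<le> e" if "0 < e" for e
  proof -
    have "0 < e / K" using that K by simp
    then obtain c n where p: "\<And>s. s \<in> {0..1} \<Longrightarrow> \<bar>u s - (\<Sum>i\<le>n. c i * s ^ i)\<bar> < e / K"
      using polynomial_approx_01[OF assms(3)] by blast
    define p where "p = (\<lambda>s. \<Sum>i\<le>n. c i * s ^ i)"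
    have cp: "continuous_on {0..1} p" unfolding p_def by (intro continuous_intros)
    define w where "w = (\<lambda>s. u s - p s)"
    have cw: "continuous_on {0..1} w" unfolding w_def using cp assms(3) by (intro continuous_intros)
    note sub = continuous_on_subset_01
    have wb: "\<bar>w s\<bar> \<le> e / K" if "s \<in> {0..1}" for s
      using p[OF that] by (simp add: w_def p_def)
    have u: "RL_integral d u s = RL_integral d p s + RL_integral d w s" if "0 \<le> d" "s \<in> {0..1}" for d s
      using RL_integral_add[of d s p w] sub[OF cp] sub[OF cw] that by (simp add: w_def)
    have "RL_integral a (RL_integral b p) t
        = RL_integral a (\<lambda>s. \<Sum>i\<le>n. c i * (Gamma (real i + 1) / Gamma (real i + 1 + b)) * s powr (real i + b)) t"
      using ab assms(4) by (intro RL_integral_cong) (auto simp: p_def RL_integral_polynomial)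
    also have "\<dots> = (\<Sum>i\<le>n. c i * (Gamma (real i + 1) / Gamma (real i + 1 + b)) *
        (Gamma (real i + b + 1) / Gamma (real i + b + 1 + a) * t powr (real i + b + a)))"
    proof (subst RL_integral_sum)
      show "continuous_on {0..t} (\<lambda>s. s powr (real i + b))" for i
        using ab by (intro continuous_on_powr' continuous_intros) auto
    qed (use ab assms(4) in \<open>auto simp: RL_integral_powr\<close>)
    \<comment> \<open>The denominator \<open>Gamma (real i + 1 + b)\<close> of the inner integration
      is the numerator of the outer one.\<close>
    also have "\<dots> = (\<Sum>i\<le>n. c i * (Gamma (real i + 1) / Gamma (real i + 1 + (a + b))) * t powr (real i + (a + b)))"
    proof (rule sum.cong[OF refl])
      fix i
      have "0 < Gamma (real i + 1 + b)" using ab by (intro Gamma_real_pos) auto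
      then show "c i * (Gamma (real i + 1) / Gamma (real i + 1 + b)) *
        (Gamma (real i + b + 1) / Gamma (real i + b + 1 + a) * t powr (real i + b + a))
        = c i * (Gamma (real i + 1) / Gamma (real i + 1 + (a + b))) * t powr (real i + (a + b))"
        by (simp add: add_ac)
    qed
    also have "\<dots> = RL_integral (a + b) p t"
      using ab assms(4) unfolding p_def by (subst RL_integral_polynomial) auto
    finally have P: "RL_integral a (RL_integral b p) t = RL_integral (a + b) p t" .
    have "RL_integral a (RL_integral b u) t = RL_integral a (\<lambda>s. RL_integral b p s + RL_integral b w s) t"
      using u ab assms(4) by (intro RL_integral_cong) auto
    also have "\<dots> = RL_integral a (RL_integral b p) t + RL_integral a (RL_integral b w) t"
      using ab assms(4) cp cw by (intro RL_integral_add; simp add: sub continuous_on_RL_integral)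
    \<comment> \<open>The polynomial part cancels by \<open>P\<close>; only the small remainder
      \<open>w\<close> is left.\<close>
    finally have *: "RL_integral a (RL_integral b u) t - RL_integral (a + b) u t
        = RL_integral a (RL_integral b w) t - RL_integral (a + b) w t"
      using u[of "a + b" t] P ab assms(4) by simp
    have "\<bar>RL_integral a (RL_integral b w) t\<bar> \<le> (e / K / Gamma (b + 1)) / Gamma (a + 1)"
    proof (rule RL_integral_const_bound)
      show "\<bar>RL_integral b w s\<bar> \<le> e / K / Gamma (b + 1)" if "s \<in> {0..t}" for s
        using that ab assms(4) wb sub[OF cw] by (intro RL_integral_const_bound) auto
    qed (use ab assms(4) cw in \<open>auto intro!: sub[OF continuous_on_RL_integral]\<close>)
    moreover have "\<bar>RL_integral (a + b) w t\<bar> \<le> (e / K) / Gamma (a + b + 1)"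
      using ab assms(4) cw wb sub[OF cw] by (intro RL_integral_const_bound) auto
    moreover have "(d / Gamma (b + 1)) / Gamma (a + 1) + d / Gamma (a + b + 1) = d * K" for d
      by (simp add: K_def distrib_left)
    ultimately have "\<bar>RL_integral a (RL_integral b w) t - RL_integral (a + b) w t\<bar> \<le> e / K * K"
      by (smt (verit, best))
    then show ?thesis using K by (simp add: *)
  qed
  then have "\<bar>RL_integral a (RL_integral b u) t - RL_integral (a + b) u t\<bar> \<le> 0"
    by - (rule field_le_epsilon, simp)
  then show ?thesis by simp
qed

section \<open>Order one: the fundamental theorem of calculus and injectivity\<close>

lemma RL_integral_1: "RL_integral 1 u t = integral {0..t} u"
proof -
  \<comment> \<open>The kernel is 1 except at \<open>s = t\<close>, where
    \<open>0 powr 0 = 0\<close>.\<close>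
  have "integral {0..t} (\<lambda>s. (t - s) powr (1 - 1) * u s) = integral {0..t} u"
    by (rule integral_spike[of "{t}"]) auto
  then show ?thesis by (simp add: RL_integral_def)
qed

lemma RL_integral_1_has_derivative:
  assumes "continuous_on {0..1} u" "t \<in> {0..1}"
  shows "(RL_integral 1 u has_vector_derivative u t) (at t within {0..1})"
  unfolding RL_integral_1[abs_def] using assms by (rule integral_has_vector_derivative)

lemma deriv01_eqI:
  assumes "(x has_vector_derivative d) (at t within {0..1})" "t \<in> {0..1}"
  shows "deriv01 x t = d"
  using vector_derivative_within_closed_interval[of 0 1 t x d] assms by (simp add: deriv01_def)

text \<open>Integrating both sides to the further order \<open>1 - a\<close> yields ordinary
  antiderivatives, by the semigroup law; differentiating these recovers \<open>u\<close> and
  \<open>v\<close>.\<close>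

lemma RL_integral_inj:
  assumes "0 \<le> a" "a \<le> 1" "continuous_on {0..1} u" "continuous_on {0..1} v"
    and "\<And>t. t \<in> {0..1} \<Longrightarrow> RL_integral a u t = RL_integral a v t" and "t \<in> {0..1}"
  shows "u t = v t"
proof -
  have eq: "RL_integral 1 u s = RL_integral 1 v s" if "s \<in> {0..1}" for s
  proof -
    have "RL_integral (1 - a) (RL_integral a u) s = RL_integral (1 - a) (RL_integral a v) s"
      using that assms(5) by (intro RL_integral_cong[of s "RL_integral a u"]) auto
    then show ?thesis using assms that by (simp add: RL_integral_semigroup)
  qed
  have "(RL_integral 1 u has_vector_derivative v t) (at t within {0..1})"
    by (rule has_vector_derivative_transform[OF _ eq RL_integral_1_has_derivative]) (use assms in auto)
  then show ?thesis
    using RL_integral_1_has_derivative[of u t] assms deriv01_eqI by metis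
qed

subsection \<open>Caputo derivatives\<close>

lemma has_vector_derivative_deriv01:
  assumes "C1_01 x" "t \<in> {0..1}"
  shows "(x has_vector_derivative deriv01 x t) (at t within {0..1})"
  using assms by (auto simp: C1_01_def deriv01_def vector_derivative_works)

lemma C1_01_I:
  assumes "\<And>t. t \<in> {0..1} \<Longrightarrow> (x has_vector_derivative x' t) (at t within {0..1})"
    and "continuous_on {0..1} x'"
  shows "C1_01 x"
  unfolding C1_01_def
proof
  show "\<forall>t\<in>{0..1}. x differentiable at t within {0..1}"
    using assms(1) differentiableI_vector by blast
  show "continuous_on {0..1} (deriv01 x)"
    by (rule continuous_on_eq[OF assms(2)]) (use deriv01_eqI[OF assms(1)] in auto)
qed

lemma C1_01_continuous_on: "C1_01 x \<Longrightarrow> continuous_on {0..1} x"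
  by (meson continuous_on_vector_derivative has_vector_derivative_deriv01)

lemma C1_01_eq_RL_integral:
  assumes "C1_01 x" "t \<in> {0..1}"
  shows "x t = x 0 + RL_integral 1 (deriv01 x) t"
proof -
  have "(deriv01 x has_integral x t - x 0) {0..t}"
  proof (rule fundamental_theorem_of_calculus)
    fix s assume "s \<in> {0..t}"
    then show "(x has_vector_derivative deriv01 x s) (at s within {0..t})"
      using assms(2)
      by (intro has_vector_derivative_within_subset[OF has_vector_derivative_deriv01[OF assms(1)]]) auto
  qed (use assms in auto)
  then show ?thesis by (simp add: RL_integral_1 integral_unique)
qed

text \<open>Taylor's formula with integral remainder, where the semigroup law merges the two
  successive antiderivatives.\<close>

lemma C2_01_eq_RL_integral:
  assumes "C2_01 z" "z 0 = 0" "deriv01 z 0 = 0" "t \<in> {0..1}"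
  shows "z t = RL_integral 2 (deriv01 (deriv01 z)) t"
proof -
  have C: "C1_01 z" "C1_01 (deriv01 z)" using assms(1) by (auto simp: C2_01_def)
  have "z t = RL_integral 1 (deriv01 z) t"
    using C1_01_eq_RL_integral[OF C(1) assms(4)] assms(2) by simp
  also have "\<dots> = RL_integral 1 (RL_integral 1 (deriv01 (deriv01 z))) t"
    using C1_01_eq_RL_integral[OF C(2)] assms(3,4) by (intro RL_integral_cong) auto
  also have "\<dots> = RL_integral 2 (deriv01 (deriv01 z)) t"
    using C(2) assms(4) by (subst RL_integral_semigroup) (auto simp: C1_01_def)
  finally show ?thesis .
qed

text \<open>Since \<open>x\<close> is only known to be C^1, the argument runs through the remainder
  \<open>z\<close>, which is C^2. With \<open>y\<close> denoting \<open>x\<close> minus its linear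
  Taylor polynomial, the integral of order \<open>2 - q\<close> of \<open>y\<close> is
  \<open>z\<close>, the second antiderivative of \<open>h\<close>, hence also the integral of order
  \<open>2 - q\<close> of \<open>RL_integral q h\<close>. Injectivity removes the outer
  integral.\<close>

lemma caputo_eq_imp_RL_integral:
  assumes q: "1 < q" "q \<le> 2" and x: "has_caputo q x"
    and h: "continuous_on {0..1} h" "\<And>t. t \<in> {0..1} \<Longrightarrow> caputo q x t = h t"
    and t: "t \<in> {0..1}"
  shows "x t = RL_integral q h t + x 0 + deriv01 x 0 * t"
proof -
  have C1: "C1_01 x" and C2: "C2_01 (caputo_remainder q x)"
    using x q by (auto simp: has_caputo_def)
  define y where "y = (\<lambda>s. x s - x 0 - deriv01 x 0 * s)"
  define d where "d = (\<lambda>s. deriv01 x s - deriv01 x 0)"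
  have d: "continuous_on {0..1} d"
    using C1 by (auto simp: d_def C1_01_def intro: continuous_intros)
  have y': "(y has_vector_derivative d s) (at s within {0..1})" if "s \<in> {0..1}" for s
    unfolding y_def d_def
    by (rule derivative_eq_intros has_vector_derivative_deriv01[OF C1 that] | simp)+
  have "C1_01 y" by (rule C1_01_I[OF y' d])
  have y: "y s = RL_integral 1 d s" if "s \<in> {0..1}" for s
  proof -
    have "RL_integral 1 (deriv01 y) s = RL_integral 1 d s"
      using that deriv01_eqI[OF y'] by (intro RL_integral_cong) auto
    then show ?thesis using C1_01_eq_RL_integral[OF \<open>C1_01 y\<close> that] by (simp add: y_def)
  qed
  let ?z = "caputo_remainder q x"
  have z_eq: "?z = RL_integral (2 - q) y" by (simp add: caputo_remainder_def y_def)
  have z1: "?z s = RL_integral 1 (RL_integral (2 - q) d) s" if "s \<in> {0..1}" for s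
  proof -
    \<comment> \<open>Commuting the two integrations exhibits \<open>z\<close> as an antiderivative,
      which gives its first derivative without differentiating under a singular kernel.\<close>
    have "?z s = RL_integral (2 - q) (RL_integral 1 d) s"
      unfolding z_eq using that y by (intro RL_integral_cong) auto
    also have "\<dots> = RL_integral 1 (RL_integral (2 - q) d) s"
      using q d that by (simp add: RL_integral_semigroup add.commute)
    finally show ?thesis .
  qed
  have z': "deriv01 ?z s = RL_integral (2 - q) d s" if "s \<in> {0..1}" for s
  proof (rule deriv01_eqI[OF _ that])
    show "(?z has_vector_derivative RL_integral (2 - q) d s) (at s within {0..1})"
      by (rule has_vector_derivative_transform[OF that z1 RL_integral_1_has_derivative])
         (use q d that continuous_on_RL_integral in auto)
  qed
  have z0: "?z 0 = 0" using z1[of 0] by (simp add: RL_integral_at_0)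
  \<comment> \<open>This is for \<open>q = 2\<close>, where the integral of order
    \<open>2 - q\<close> is the identity; for \<open>q < 2\<close> the integral of positive order
    vanishes at 0 by itself.\<close>
  have "d 0 = 0" by (simp add: d_def)
  then have z'0: "deriv01 ?z 0 = 0"
    using z'[of 0] q by (cases "q = 2") (auto simp: RL_integral_at_0)
  have "y t = RL_integral q h t"
  proof (rule RL_integral_inj[of "2 - q" y "RL_integral q h"])
    fix s :: real assume s: "s \<in> {0..1}"
    have "RL_integral (2 - q) y s = RL_integral 2 (deriv01 (deriv01 ?z)) s"
      using C2_01_eq_RL_integral[OF C2 z0 z'0 s] by (simp add: z_eq)
    also have "\<dots> = RL_integral 2 h s"
      using h(2) q s by (intro RL_integral_cong) (auto simp: caputo_def)
    also have "\<dots> = RL_integral (2 - q) (RL_integral q h) s"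
      using q h(1) s by (simp add: RL_integral_semigroup)
    finally show "RL_integral (2 - q) y s = RL_integral (2 - q) (RL_integral q h) s" .
  qed (use q h t C1_01_continuous_on[OF \<open>C1_01 y\<close>] continuous_on_RL_integral in auto)
  then show ?thesis by (simp add: y_def)
qed

section \<open>Converse direction: fractional antiderivatives plus an affine function\<close>

context
  fixes q c\<^sub>0 c\<^sub>1 :: real and h x :: "real \<Rightarrow> real"
  assumes q: "1 < q" "q \<le> 2" and h: "continuous_on {0..1} h"
    and x: "\<And>t. t \<in> {0..1} \<Longrightarrow> x t = RL_integral q h t + c\<^sub>0 + c\<^sub>1 * t"
begin

lemma RL_integral_affine_has_derivative:
  assumes "t \<in> {0..1}"
  shows "(x has_vector_derivative RL_integral (q - 1) h t + c\<^sub>1) (at t within {0..1})"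
proof -
  have c: "continuous_on {0..1} (RL_integral (q - 1) h)"
    using q h by (intro continuous_on_RL_integral) auto
  have "x s = RL_integral 1 (RL_integral (q - 1) h) s + c\<^sub>0 + c\<^sub>1 * s" if "s \<in> {0..1}" for s
    using x that q h by (simp add: RL_integral_semigroup)
  then show ?thesis
    by (rule has_vector_derivative_transform[OF assms])
       (rule derivative_eq_intros RL_integral_1_has_derivative[OF c assms] | simp)+
qed

lemma RL_integral_affine_C1_01: "C1_01 x"
  using q h by (intro C1_01_I[OF RL_integral_affine_has_derivative] continuous_intros continuous_on_RL_integral) auto

lemma deriv01_RL_integral_affine: "t \<in> {0..1} \<Longrightarrow> deriv01 x t = RL_integral (q - 1) h t + c\<^sub>1"
  by (intro deriv01_eqI RL_integral_affine_has_derivative)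

text \<open>The integrals of \<open>h\<close> of orders \<open>q\<close> and \<open>q - 1\<close>
  vanish at 0, so subtracting the Taylor polynomial of \<open>x\<close> removes exactly the affine
  part. The result is left as an iterated integral of order one, ready to be differentiated
  twice.\<close>

lemma caputo_remainder_RL_integral_affine:
  assumes "t \<in> {0..1}"
  shows "caputo_remainder q x t = RL_integral 1 (RL_integral 1 h) t"
proof -
  have "x 0 = c\<^sub>0" using x[of 0] q by (simp add: RL_integral_at_0)
  moreover have "deriv01 x 0 = c\<^sub>1"
    using deriv01_RL_integral_affine[of 0] q by (simp add: RL_integral_at_0)
  ultimately have "caputo_remainder q x t = RL_integral (2 - q) (RL_integral q h) t"
    unfolding caputo_remainder_def using x assms by (intro RL_integral_cong) auto
  then show ?thesis using q h assms by (simp add: RL_integral_semigroup)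
qed

lemma deriv01_caputo_remainder_RL_integral_affine:
  assumes "t \<in> {0..1}"
  shows "(caputo_remainder q x has_vector_derivative RL_integral 1 h t) (at t within {0..1})"
  by (rule has_vector_derivative_transform[OF assms caputo_remainder_RL_integral_affine RL_integral_1_has_derivative])
     (use h assms in \<open>auto intro: continuous_on_RL_integral\<close>)

lemma deriv01_deriv01_caputo_remainder_RL_integral_affine:
  assumes "t \<in> {0..1}"
  shows "(deriv01 (caputo_remainder q x) has_vector_derivative h t) (at t within {0..1})"
  by (rule has_vector_derivative_transform[OF assms
        deriv01_eqI[OF deriv01_caputo_remainder_RL_integral_affine] RL_integral_1_has_derivative])
     (use h assms in auto)

lemma RL_integral_affine_has_caputo: "has_caputo q x"
  unfolding has_caputo_def C2_01_def
  using RL_integral_affine_C1_01 C1_01_I[OF deriv01_caputo_remainder_RL_integral_affine]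
    C1_01_I[OF deriv01_deriv01_caputo_remainder_RL_integral_affine] h continuous_on_RL_integral[of 1 h]
  by auto

lemma caputo_RL_integral_affine: "t \<in> {0..1} \<Longrightarrow> caputo q x t = h t"
  using q deriv01_eqI[OF deriv01_deriv01_caputo_remainder_RL_integral_affine] by (simp add: caputo_def)

text \<open>The semigroup law handles the integral part of the derivative of \<open>x\<close>, and
  the constant \<open>c\<^sub>1\<close> contributes a power of \<open>t\<close>. Positivity of
  \<open>t\<close> matters at \<open>\<mu> = 1\<close>, where \<open>t powr (1 - \<mu>)\<close> must
  be 1 while \<open>0 powr 0 = 0\<close>.\<close>

lemma caputo_le_1_RL_integral_affine:
  assumes "0 < \<mu>" "\<mu> \<le> 1" "0 < t" "t \<le> 1"
  shows "caputo \<mu> x t = RL_integral (q - \<mu>) h t + c\<^sub>1 * t powr (1 - \<mu>) / Gamma (2 - \<mu>)"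
proof (cases "\<mu> = 1")
  case True
  then show ?thesis using assms deriv01_RL_integral_affine[of t] by (simp add: caputo_def)
next
  case False
  with assms have \<mu>: "0 < 1 - \<mu>" by simp
  have c: "continuous_on {0..1} (RL_integral (q - 1) h)"
    using q h by (intro continuous_on_RL_integral) auto
  have "caputo \<mu> x t = RL_integral (1 - \<mu>) (\<lambda>s. RL_integral (q - 1) h s + c\<^sub>1 * s ^ 0) t"
    using assms deriv01_RL_integral_affine by (auto simp: caputo_def intro!: RL_integral_cong)
  also have "\<dots> = RL_integral (1 - \<mu>) (RL_integral (q - 1) h) t + c\<^sub>1 * RL_integral (1 - \<mu>) (\<lambda>s. s ^ 0) t"
    using assms continuous_on_subset[OF c, of "{0..t}"]
    by (subst RL_integral_add) (auto simp only: RL_integral_cmult intro!: continuous_intros, auto)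
  also have "\<dots> = RL_integral (q - \<mu>) h t + c\<^sub>1 * (1 / Gamma (2 - \<mu>) * t powr (1 - \<mu>))"
    using RL_integral_power[OF \<mu>, of t 0] RL_integral_semigroup[of "1 - \<mu>" "q - 1" h t] assms q h
    by (simp add: add_ac)
  finally show ?thesis by simp
qed

lemma integral_RL_integral_affine:
  assumes "t \<in> {0..1}"
  shows "integral {0..t} x = RL_integral (q + 1) h t + c\<^sub>0 * t + c\<^sub>1 * t\<^sup>2 / 2"
proof -
  have c: "continuous_on {0..1} (RL_integral q h)"
    using q h by (intro continuous_on_RL_integral) auto
  then have "(RL_integral q h has_integral integral {0..t} (RL_integral q h)) {0..t}"
    using assms by (intro integrable_integral integrable_continuous_real continuous_on_subset[OF c]) auto
  moreover have "integral {0..t} (RL_integral q h) = RL_integral (q + 1) h t"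
    unfolding RL_integral_1[symmetric] using q h assms by (simp add: RL_integral_semigroup add.commute)
  ultimately have "((\<lambda>s. RL_integral q h s + c\<^sub>0 + c\<^sub>1 * s) has_integral
      RL_integral (q + 1) h t + c\<^sub>0 * t + c\<^sub>1 * (t\<^sup>2 / 2)) {0..t}"
    using assms has_integral_const_real[of c\<^sub>0 0 t] ident_has_integral[of 0 t]
    by (intro has_integral_add has_integral_mult_right) (auto simp: mult.commute)
  then have "(x has_integral RL_integral (q + 1) h t + c\<^sub>0 * t + c\<^sub>1 * (t\<^sup>2 / 2)) {0..t}"
    by (rule has_integral_eq[rotated]) (use x assms in auto)
  then show ?thesis by (simp add: integral_unique)
qed

end

text \<open>The integral of order \<open>a\<close> is an antiderivative of the one of order
  \<open>a - 1\<close>, which is nonnegative. This allows bounds uniform in \<open>t\<close> to be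
  read off at \<open>t = 1\<close>.\<close>

lemma RL_integral_mono_endpoint:
  assumes "1 \<le> a" "continuous_on {0..1} g" "\<And>s. s \<in> {0..1} \<Longrightarrow> 0 \<le> g s"
    and "0 \<le> s" "s \<le> t" "t \<le> 1"
  shows "RL_integral a g s \<le> RL_integral a g t"
proof -
  have c: "continuous_on {0..1} (RL_integral (a - 1) g)"
    using assms by (intro continuous_on_RL_integral) auto
  have "RL_integral a g r = integral {0..r} (RL_integral (a - 1) g)" if "r \<in> {0..1}" for r
    unfolding RL_integral_1[symmetric] using assms that by (simp add: RL_integral_semigroup)
  moreover have "integral {0..s} (RL_integral (a - 1) g) \<le> integral {0..t} (RL_integral (a - 1) g)"
    using assms
    by (intro integral_subset_le integrable_continuous_real continuous_on_subset[OF c] ballI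
        RL_integral_nonneg continuous_on_subset[OF assms(2)]) auto
  ultimately show ?thesis using assms by auto
qed

subsection \<open>Nonlinear contractions\<close>

text \<open>A Boyd-Wong type theorem. Banach's theorem would not do for
  \<open>\<phi> r = ln (1 + r)\<close>, because \<open>\<phi> r / r\<close> tends to 1 as
  \<open>r\<close> tends to 0.\<close>

lemma comparison_contraction_fixed_point:
  fixes T :: "'a::complete_space \<Rightarrow> 'a" and \<phi> :: "real \<Rightarrow> real"
  assumes dist_T: "\<And>x y. dist (T x) (T y) \<le> \<phi> (dist x y)"
    and mono: "mono_on {0..} \<phi>" and cont: "continuous_on {0..} \<phi>"
    and less: "\<And>r. 0 < r \<Longrightarrow> \<phi> r < r"
  shows "\<exists>x. T x = x"
proof -
  have nonexpansive: "dist (T x) (T y) \<le> dist x y" for x y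
    using dist_T[of x y] less[of "dist x y"] by (cases "x = y") auto
  \<comment> \<open>\<open>undefined\<close> serves as an arbitrary starting point.\<close>
  define X where "X n = (T ^^ n) undefined" for n
  have X_Suc: "X (Suc n) = T (X n)" for n by (simp add: X_def)
  define d where "d n = dist (X n) (X (Suc n))" for n
  have d0: "d \<longlonglongrightarrow> 0"
  proof -
    have "decseq d" unfolding decseq_Suc_iff d_def X_Suc using nonexpansive by simp
    moreover have "0 \<le> d n" for n by (simp add: d_def)
    ultimately obtain L where L: "d \<longlonglongrightarrow> L" "\<And>n. L \<le> d n"
      using decseq_convergent[of d 0] by auto
    have "0 \<le> L" using L(1) LIMSEQ_le_const[of d L 0] by (auto simp: d_def)
    have "(\<lambda>n. \<phi> (d n)) \<longlonglongrightarrow> \<phi> L"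
      by (rule continuous_on_tendsto_compose[OF cont L(1)]) (use \<open>0 \<le> L\<close> in \<open>auto simp: d_def\<close>)
    moreover have "d (Suc n) \<le> \<phi> (d n)" for n
      using dist_T by (simp add: d_def X_Suc)
    \<comment> \<open>Passing to the limit in \<open>d (Suc n) \<le> \<phi> (d n)\<close> excludes a
      positive limit of the step lengths.\<close>
    ultimately have "L \<le> \<phi> L"
      using LIMSEQ_le[OF LIMSEQ_Suc[OF L(1)]] by blast
    with less[of L] \<open>0 \<le> L\<close> have "L = 0" by (cases "L = 0") auto
    with L(1) show ?thesis by simp
  qed
  have "Cauchy X"
  proof (rule metric_CauchyI)
    fix e :: real assume "0 < e"
    \<comment> \<open>Two points within \<open>r\<close> of \<open>X N\<close> are at distance at
      most \<open>2 * r\<close>, which is less than \<open>e\<close>.\<close>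
    define r where "r = e / 3"
    have r: "0 < r" using \<open>0 < e\<close> by (simp add: r_def)
    have "\<forall>\<^sub>F n in sequentially. d n < r - \<phi> r"
      using order_tendstoD(2)[OF d0, of "r - \<phi> r"] less[OF r] by simp
    then obtain N where N: "d N < r - \<phi> r" by (auto simp: eventually_sequentially)
    have ball: "dist (X m) (X N) \<le> r" if "m \<ge> N" for m
      using that
    proof (induction m rule: dec_induct)
      case (step m)
      have "\<phi> (dist (X m) (X N)) \<le> \<phi> r"
        using step r by (intro mono_onD[OF mono]) auto
      then have "dist (X (Suc m)) (X (Suc N)) \<le> \<phi> r"
        using dist_T[of "X m" "X N"] by (simp add: X_Suc)
      then show ?case
        using dist_triangle[of "X (Suc m)" "X N" "X (Suc N)"] N by (simp add: d_def dist_commute)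
    qed (use r in auto)
    show "\<exists>M. \<forall>m\<ge>M. \<forall>n\<ge>M. dist (X m) (X n) < e"
    proof (intro exI[of _ "N"] allI impI)
      fix m n assume "N \<le> m" "N \<le> n"
      then show "dist (X m) (X n) < e"
        using ball[of m] ball[of n] dist_triangle2[of "X m" "X n" "X N"] \<open>0 < e\<close> by (simp add: r_def)
    qed
  qed
  then obtain x where x: "X \<longlonglongrightarrow> x" by (auto simp: Cauchy_convergent_iff convergent_def)
  \<comment> \<open>Nonexpansiveness supplies the continuity of \<open>T\<close> at
    \<open>x\<close>.\<close>
  have "(\<lambda>n. dist (X (Suc n)) (T x)) \<longlonglongrightarrow> 0"
  proof (rule tendsto_sandwich[OF _ _ tendsto_const])
    show "(\<lambda>n. dist (X n) x) \<longlonglongrightarrow> 0" using x tendsto_dist_iff by blast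
  qed (auto simp: X_Suc nonexpansive)
  then have "(\<lambda>n. X (Suc n)) \<longlonglongrightarrow> T x" using tendsto_dist_iff by blast
  with LIMSEQ_Suc[OF x] show ?thesis by (metis LIMSEQ_unique)
qed

subsection \<open>The boundary value problem\<close>

locale fractional_bvp =
  fixes q \<sigma> \<nu> \<xi> :: real and n :: nat and \<eta> \<alpha> \<beta> \<gamma> :: "nat \<Rightarrow> real"
    and \<Delta>\<^sub>1 \<Delta>\<^sub>2 \<Delta>\<^sub>3 :: real
  assumes q: "1 < q" "q \<le> 2" and \<sigma>: "0 < \<sigma>" "\<sigma> \<le> 1" and \<nu>: "0 < \<nu>" "\<nu> \<le> 1"
    and \<xi>: "0 < \<xi>" "\<xi> < 1" and \<eta>: "\<And>i. i \<in> {1..n} \<Longrightarrow> 0 < \<eta> i" "\<And>i. i \<in> {1..n} \<Longrightarrow> \<eta> i < 1"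
    and \<Delta>\<^sub>1: "\<Delta>\<^sub>1 = \<xi> powr (1 - \<sigma>) * Gamma (2 - \<nu>)
               - Gamma (2 - \<sigma>) * (\<Sum>i=1..n. \<alpha> i * \<eta> i powr (1 - \<nu>))"
    and \<Delta>\<^sub>2: "\<Delta>\<^sub>2 = 1 - (\<Sum>i=1..n. \<beta> i * \<eta> i + \<gamma> i)"
    and \<Delta>\<^sub>3: "\<Delta>\<^sub>3 = - 2 + (\<Sum>i=1..n. \<eta> i * (\<beta> i * \<eta> i + 2 * \<gamma> i))"
    and nonzero: "\<Delta>\<^sub>1 \<noteq> 0" "\<Delta>\<^sub>2 \<noteq> 0"
begin

lemma \<xi>_01: "\<xi> \<in> {0..1}" and \<eta>_01: "i \<in> {1..n} \<Longrightarrow> \<eta> i \<in> {0..1}"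
  using \<xi> \<eta>[of i] by auto

lemma Gamma_pos: "0 < Gamma (2 - \<sigma>)" "0 < Gamma (2 - \<nu>)"
  using \<sigma> \<nu> by (auto intro!: Gamma_real_pos)

text \<open>The value of \<open>c\<^sub>1\<close> forced by the fractional boundary condition, from
  which \<open>c\<^sub>0\<close> is absent because Caputo derivatives annihilate constants.\<close>

definition slope :: "(real \<Rightarrow> real) \<Rightarrow> real" where
  "slope h = Gamma (2 - \<sigma>) * Gamma (2 - \<nu>) / \<Delta>\<^sub>1 *
     ((\<Sum>i=1..n. \<alpha> i * RL_integral (q - \<nu>) h (\<eta> i)) - RL_integral (q - \<sigma>) h \<xi>)"

text \<open>The value of \<open>c\<^sub>0\<close> forced by the other condition once
  \<open>c\<^sub>1\<close> is the slope; \<open>\<Delta>\<^sub>3 / 2\<close> is the coefficient with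
  which \<open>c\<^sub>1\<close> enters.\<close>

definition offset :: "(real \<Rightarrow> real) \<Rightarrow> real" where
  "offset h = ((\<Sum>i=1..n. \<beta> i * RL_integral (q + 1) h (\<eta> i) + \<gamma> i * RL_integral q h (\<eta> i))
     - RL_integral q h 1 + slope h * \<Delta>\<^sub>3 / 2) / \<Delta>\<^sub>2"

definition linear_solution :: "(real \<Rightarrow> real) \<Rightarrow> real \<Rightarrow> real" where
  "linear_solution h t = RL_integral q h t + offset h + slope h * t"

text \<open>This is the constant \<Phi> in terms of Riemann-Liouville integrals;
  \<open>linear_bound_eq_integrals\<close> identifies the two.\<close>

definition linear_bound :: "(real \<Rightarrow> real) \<Rightarrow> real" where
  "linear_bound g =
     (1 + 1 / \<bar>\<Delta>\<^sub>2\<bar>) * RL_integral q g 1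
     + 1 / \<bar>\<Delta>\<^sub>2\<bar> * (\<Sum>i=1..n. \<bar>\<gamma> i\<bar> * RL_integral q g (\<eta> i) + \<bar>\<beta> i\<bar> * RL_integral (q + 1) g (\<eta> i))
     + Gamma (2 - \<sigma>) * Gamma (2 - \<nu>) * (\<bar>\<Delta>\<^sub>3\<bar> + 2 * \<bar>\<Delta>\<^sub>2\<bar>) / (2 * \<bar>\<Delta>\<^sub>1 * \<Delta>\<^sub>2\<bar>)
       * (RL_integral (q - \<sigma>) g \<xi> + (\<Sum>i=1..n. \<bar>\<alpha> i\<bar> * RL_integral (q - \<nu>) g (\<eta> i)))"

lemma boundary_conditions_iff:
  assumes h: "continuous_on {0..1} h"
    and x: "\<And>t. t \<in> {0..1} \<Longrightarrow> x t = RL_integral q h t + c\<^sub>0 + c\<^sub>1 * t"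
  shows "caputo \<sigma> x \<xi> = (\<Sum>i=1..n. \<alpha> i * caputo \<nu> x (\<eta> i)) \<and>
      x 1 = (\<Sum>i=1..n. \<beta> i * integral {0..\<eta> i} x) + (\<Sum>i=1..n. \<gamma> i * x (\<eta> i))
    \<longleftrightarrow> c\<^sub>1 = slope h \<and> c\<^sub>0 = offset h"
proof -
  define A where "A = (\<Sum>i=1..n. \<alpha> i * RL_integral (q - \<nu>) h (\<eta> i))"
  define S where "S = (\<Sum>i=1..n. \<alpha> i * \<eta> i powr (1 - \<nu>))"
  define B where "B = (\<Sum>i=1..n. \<beta> i * RL_integral (q + 1) h (\<eta> i) + \<gamma> i * RL_integral q h (\<eta> i))"
  have 1: "caputo \<sigma> x \<xi> = RL_integral (q - \<sigma>) h \<xi> + c\<^sub>1 * \<xi> powr (1 - \<sigma>) / Gamma (2 - \<sigma>)"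
    using \<xi> \<sigma> by (intro caputo_le_1_RL_integral_affine[OF q h x]) auto
  have "(\<Sum>i=1..n. \<alpha> i * caputo \<nu> x (\<eta> i)) =
     (\<Sum>i=1..n. \<alpha> i * RL_integral (q - \<nu>) h (\<eta> i) + c\<^sub>1 / Gamma (2 - \<nu>) * (\<alpha> i * \<eta> i powr (1 - \<nu>)))"
  proof (rule sum.cong[OF refl])
    fix i assume "i \<in> {1..n}"
    then have "caputo \<nu> x (\<eta> i) = RL_integral (q - \<nu>) h (\<eta> i) + c\<^sub>1 * \<eta> i powr (1 - \<nu>) / Gamma (2 - \<nu>)"
      using \<eta>[of i] \<nu> by (intro caputo_le_1_RL_integral_affine[OF q h x]) auto
    then show "\<alpha> i * caputo \<nu> x (\<eta> i) =
      \<alpha> i * RL_integral (q - \<nu>) h (\<eta> i) + c\<^sub>1 / Gamma (2 - \<nu>) * (\<alpha> i * \<eta> i powr (1 - \<nu>))"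
      by (simp add: algebra_simps)
  qed
  then have 2: "(\<Sum>i=1..n. \<alpha> i * caputo \<nu> x (\<eta> i)) = A + c\<^sub>1 / Gamma (2 - \<nu>) * S"
    by (simp only: A_def S_def sum.distrib sum_distrib_left)
  \<comment> \<open>Multiplying by both Gamma values clears the denominators and leaves
    \<open>\<Delta>\<^sub>1\<close> as the coefficient of \<open>c\<^sub>1\<close>.\<close>
  have "caputo \<sigma> x \<xi> = (\<Sum>i=1..n. \<alpha> i * caputo \<nu> x (\<eta> i))
     \<longleftrightarrow> c\<^sub>1 * \<Delta>\<^sub>1 = Gamma (2 - \<sigma>) * Gamma (2 - \<nu>) * (A - RL_integral (q - \<sigma>) h \<xi>)"
    unfolding 1 2 \<Delta>\<^sub>1 S_def[symmetric] using Gamma_pos by (simp add: field_simps)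
  also have "\<dots> \<longleftrightarrow> c\<^sub>1 = slope h"
    unfolding slope_def A_def[symmetric] using nonzero by (simp add: field_simps)
  finally have bc1: "caputo \<sigma> x \<xi> = (\<Sum>i=1..n. \<alpha> i * caputo \<nu> x (\<eta> i)) \<longleftrightarrow> c\<^sub>1 = slope h" .
  have "(\<Sum>i=1..n. \<beta> i * integral {0..\<eta> i} x) + (\<Sum>i=1..n. \<gamma> i * x (\<eta> i))
    = (\<Sum>i=1..n. (\<beta> i * RL_integral (q + 1) h (\<eta> i) + \<gamma> i * RL_integral q h (\<eta> i))
        + c\<^sub>0 * (\<beta> i * \<eta> i + \<gamma> i) + c\<^sub>1 / 2 * (\<eta> i * (\<beta> i * \<eta> i + 2 * \<gamma> i)))"
    unfolding sum.distrib[symmetric]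
  proof (rule sum.cong[OF refl])
    fix i assume i: "i \<in> {1..n}"
    show "\<beta> i * integral {0..\<eta> i} x + \<gamma> i * x (\<eta> i)
      = \<beta> i * RL_integral (q + 1) h (\<eta> i) + \<gamma> i * RL_integral q h (\<eta> i)
        + c\<^sub>0 * (\<beta> i * \<eta> i + \<gamma> i) + c\<^sub>1 / 2 * (\<eta> i * (\<beta> i * \<eta> i + 2 * \<gamma> i))"
      using integral_RL_integral_affine[OF q h x \<eta>_01[OF i]] x[OF \<eta>_01[OF i]]
      by (simp add: algebra_simps power2_eq_square)
  qed
  then have 3: "(\<Sum>i=1..n. \<beta> i * integral {0..\<eta> i} x) + (\<Sum>i=1..n. \<gamma> i * x (\<eta> i))
    = B + c\<^sub>0 * (\<Sum>i=1..n. \<beta> i * \<eta> i + \<gamma> i) + c\<^sub>1 / 2 * (\<Sum>i=1..n. \<eta> i * (\<beta> i * \<eta> i + 2 * \<gamma> i))"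
    unfolding B_def sum_distrib_left sum.distrib[symmetric] .
  \<comment> \<open>The coefficients 1 of \<open>c\<^sub>0\<close> and \<open>c\<^sub>1\<close> here
    account for the constants 1 in \<open>\<Delta>\<^sub>2\<close> and -2 in
    \<open>\<Delta>\<^sub>3\<close>, the latter being twice the coefficient moved across.\<close>
  have x1: "x 1 = RL_integral q h 1 + c\<^sub>0 + c\<^sub>1" using x[of 1] by simp
  have s2: "(\<Sum>i=1..n. \<beta> i * \<eta> i + \<gamma> i) = 1 - \<Delta>\<^sub>2" and
    s3: "(\<Sum>i=1..n. \<eta> i * (\<beta> i * \<eta> i + 2 * \<gamma> i)) = \<Delta>\<^sub>3 + 2"
    using \<Delta>\<^sub>2 \<Delta>\<^sub>3 by linarith+
  have "x 1 = (\<Sum>i=1..n. \<beta> i * integral {0..\<eta> i} x) + (\<Sum>i=1..n. \<gamma> i * x (\<eta> i))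
     \<longleftrightarrow> c\<^sub>0 * \<Delta>\<^sub>2 = B - RL_integral q h 1 + c\<^sub>1 * \<Delta>\<^sub>3 / 2"
    unfolding 3 s2 s3 x1 by (auto simp: algebra_simps add_divide_distrib)
  also have "\<dots> \<longleftrightarrow> c\<^sub>0 = (B - RL_integral q h 1 + c\<^sub>1 * \<Delta>\<^sub>3 / 2) / \<Delta>\<^sub>2"
    using nonzero by (simp add: eq_divide_eq)
  finally have bc2: "x 1 = (\<Sum>i=1..n. \<beta> i * integral {0..\<eta> i} x) + (\<Sum>i=1..n. \<gamma> i * x (\<eta> i))
     \<longleftrightarrow> c\<^sub>0 = (B - RL_integral q h 1 + c\<^sub>1 * \<Delta>\<^sub>3 / 2) / \<Delta>\<^sub>2" .
  show ?thesis unfolding bc1 bc2 offset_def B_def[symmetric] by auto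
qed

text \<open>With the right-hand side frozen as \<open>h\<close>, the problem is linear. A solution
  has \<open>c\<^sub>0 = x 0\<close> and \<open>c\<^sub>1 = deriv01 x 0\<close>, and the boundary
  conditions fix both; conversely, these constants produce a solution.\<close>

lemma bvp_solution_iff:
  assumes h: "continuous_on {0..1} (\<lambda>t. f t (x t))"
  shows "bvp_solution q \<sigma> \<nu> n \<xi> \<eta> \<alpha> \<beta> \<gamma> f x \<longleftrightarrow>
    (\<forall>t\<in>{0..1}. x t = linear_solution (\<lambda>t. f t (x t)) t)" (is "?L \<longleftrightarrow> ?R")
proof
  assume L: ?L
  then have "x t = RL_integral q (\<lambda>t. f t (x t)) t + x 0 + deriv01 x 0 * t" if "t \<in> {0..1}" for t
    using that by (intro caputo_eq_imp_RL_integral[OF q _ h]) (auto simp: bvp_solution_def)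
  moreover from boundary_conditions_iff[OF h this] L
  have "deriv01 x 0 = slope (\<lambda>t. f t (x t))" "x 0 = offset (\<lambda>t. f t (x t))"
    by (auto simp: bvp_solution_def)
  ultimately show ?R by (simp add: linear_solution_def)
next
  assume ?R
  then have x: "x t = RL_integral q (\<lambda>t. f t (x t)) t + offset (\<lambda>t. f t (x t)) + slope (\<lambda>t. f t (x t)) * t"
    if "t \<in> {0..1}" for t
    using that by (simp add: linear_solution_def)
  show ?L
    unfolding bvp_solution_def
    using boundary_conditions_iff[OF h x] RL_integral_affine_C1_01[OF q h x]
      RL_integral_affine_has_caputo[OF q h x] caputo_RL_integral_affine[OF q h x]
    by blast
qed

section \<open>Estimates for the solution operator of the linear problem\<close>

lemma continuous_on_linear_solution:
  "continuous_on {0..1} h \<Longrightarrow> continuous_on {0..1} (linear_solution h)"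
  unfolding linear_solution_def[abs_def] using q
  by (intro continuous_intros continuous_on_RL_integral) auto

lemma linear_solution_diff:
  assumes "continuous_on {0..1} u" "continuous_on {0..1} v" "t \<in> {0..1}"
  shows "linear_solution (\<lambda>s. u s - v s) t = linear_solution u t - linear_solution v t"
proof -
  have RL: "RL_integral a (\<lambda>s. u s - v s) r = RL_integral a u r - RL_integral a v r"
    if "0 \<le> a" "r \<in> {0..1}" for a r
    using that by (intro RL_integral_diff continuous_on_subset_01[OF assms(1)] continuous_on_subset_01[OF assms(2)]) auto
  have slope: "slope (\<lambda>s. u s - v s) = slope u - slope v"
  proof -
    have "(\<Sum>i=1..n. \<alpha> i * RL_integral (q - \<nu>) (\<lambda>s. u s - v s) (\<eta> i))
      = (\<Sum>i=1..n. \<alpha> i * RL_integral (q - \<nu>) u (\<eta> i)) - (\<Sum>i=1..n. \<alpha> i * RL_integral (q - \<nu>) v (\<eta> i))"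
      unfolding sum_subtractf[symmetric] using q \<nu> \<eta>_01
      by (intro sum.cong refl) (simp add: RL right_diff_distrib)
    moreover have "RL_integral (q - \<sigma>) (\<lambda>s. u s - v s) \<xi> = RL_integral (q - \<sigma>) u \<xi> - RL_integral (q - \<sigma>) v \<xi>"
      using q \<sigma> \<xi>_01 by (intro RL) auto
    ultimately show ?thesis
      unfolding slope_def by (simp only: right_diff_distrib)
  qed
  have "(\<Sum>i=1..n. \<beta> i * RL_integral (q + 1) (\<lambda>s. u s - v s) (\<eta> i) + \<gamma> i * RL_integral q (\<lambda>s. u s - v s) (\<eta> i))
      = (\<Sum>i=1..n. \<beta> i * RL_integral (q + 1) u (\<eta> i) + \<gamma> i * RL_integral q u (\<eta> i))
      - (\<Sum>i=1..n. \<beta> i * RL_integral (q + 1) v (\<eta> i) + \<gamma> i * RL_integral q v (\<eta> i))"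
    unfolding sum_subtractf[symmetric] using q \<eta>_01
    by (intro sum.cong refl) (simp add: RL algebra_simps)
  moreover have "RL_integral q (\<lambda>s. u s - v s) 1 = RL_integral q u 1 - RL_integral q v 1"
    using q by (intro RL) auto
  ultimately have "offset (\<lambda>s. u s - v s) = offset u - offset v"
    unfolding offset_def slope by (simp only: left_diff_distrib diff_divide_distrib add_divide_distrib)
  then show ?thesis using q assms(3) by (simp add: linear_solution_def slope RL algebra_simps)
qed

lemma abs_linear_solution_le:
  assumes h: "continuous_on {0..1} h" and g: "continuous_on {0..1} g"
    and le: "\<And>s. s \<in> {0..1} \<Longrightarrow> \<bar>h s\<bar> \<le> g s" and t: "t \<in> {0..1}"
  shows "\<bar>linear_solution h t\<bar> \<le> linear_bound g"
proof -
  have RL: "\<bar>RL_integral a h r\<bar> \<le> RL_integral a g r" if "0 \<le> a" "r \<in> {0..1}" for a r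
    using that le by (intro RL_integral_abs_le continuous_on_subset_01[OF h] continuous_on_subset_01[OF g]) auto
  have g0: "0 \<le> g s" if "s \<in> {0..1}" for s using le[OF that] by linarith
  define A where "A = RL_integral (q - \<sigma>) g \<xi> + (\<Sum>i=1..n. \<bar>\<alpha> i\<bar> * RL_integral (q - \<nu>) g (\<eta> i))"
  define B where "B = (\<Sum>i=1..n. \<bar>\<gamma> i\<bar> * RL_integral q g (\<eta> i) + \<bar>\<beta> i\<bar> * RL_integral (q + 1) g (\<eta> i))"
  \<comment> \<open>\<open>M\<close> bounds the slope. It enters once through
    \<open>slope h * t\<close> and once, with factor \<open>\<bar>\<Delta>\<^sub>3\<bar> / (2 *
    \<bar>\<Delta>\<^sub>2\<bar>)\<close>, through the offset; together these give the last
    coefficient of \<Phi>.\<close>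
  define M where "M = Gamma (2 - \<sigma>) * Gamma (2 - \<nu>) / \<bar>\<Delta>\<^sub>1\<bar> * A"
  have "\<bar>\<Sum>i=1..n. \<alpha> i * RL_integral (q - \<nu>) h (\<eta> i)\<bar> \<le> (\<Sum>i=1..n. \<bar>\<alpha> i\<bar> * RL_integral (q - \<nu>) g (\<eta> i))"
    using q \<nu> \<eta>_01 by (intro order_trans[OF sum_abs] sum_mono) (auto simp: abs_mult intro!: mult_left_mono RL)
  moreover have "\<bar>RL_integral (q - \<sigma>) h \<xi>\<bar> \<le> RL_integral (q - \<sigma>) g \<xi>"
    using q \<sigma> \<xi>_01 by (intro RL) auto
  ultimately have "\<bar>(\<Sum>i=1..n. \<alpha> i * RL_integral (q - \<nu>) h (\<eta> i)) - RL_integral (q - \<sigma>) h \<xi>\<bar> \<le> A"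
    unfolding A_def by linarith
  then have slope: "\<bar>slope h\<bar> \<le> M"
    using Gamma_pos unfolding slope_def M_def abs_mult abs_divide
    by (intro mult_mono divide_right_mono) auto
  have B: "\<bar>\<Sum>i=1..n. \<beta> i * RL_integral (q + 1) h (\<eta> i) + \<gamma> i * RL_integral q h (\<eta> i)\<bar> \<le> B"
    unfolding B_def
  proof (intro order_trans[OF sum_abs] sum_mono)
    fix i assume i: "i \<in> {1..n}"
    have "\<bar>\<beta> i * RL_integral (q + 1) h (\<eta> i)\<bar> \<le> \<bar>\<beta> i\<bar> * RL_integral (q + 1) g (\<eta> i)"
      "\<bar>\<gamma> i * RL_integral q h (\<eta> i)\<bar> \<le> \<bar>\<gamma> i\<bar> * RL_integral q g (\<eta> i)"
      using q \<eta>_01[OF i] by (auto simp: abs_mult intro!: mult_left_mono RL)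
    then show "\<bar>\<beta> i * RL_integral (q + 1) h (\<eta> i) + \<gamma> i * RL_integral q h (\<eta> i)\<bar>
      \<le> \<bar>\<gamma> i\<bar> * RL_integral q g (\<eta> i) + \<bar>\<beta> i\<bar> * RL_integral (q + 1) g (\<eta> i)" by linarith
  qed
  have "\<bar>slope h * \<Delta>\<^sub>3 / 2\<bar> \<le> M * \<bar>\<Delta>\<^sub>3\<bar> / 2"
    using slope by (simp add: abs_mult mult_right_mono)
  with B RL[of q 1] q have "\<bar>(\<Sum>i=1..n. \<beta> i * RL_integral (q + 1) h (\<eta> i) + \<gamma> i * RL_integral q h (\<eta> i))
     - RL_integral q h 1 + slope h * \<Delta>\<^sub>3 / 2\<bar> \<le> B + RL_integral q g 1 + M * \<bar>\<Delta>\<^sub>3\<bar> / 2"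
    by (smt (verit, best) atLeastAtMost_iff)
  then have offset: "\<bar>offset h\<bar> \<le> (B + RL_integral q g 1 + M * \<bar>\<Delta>\<^sub>3\<bar> / 2) / \<bar>\<Delta>\<^sub>2\<bar>"
    unfolding offset_def abs_divide by (intro divide_right_mono) auto
  have "\<bar>slope h * t\<bar> \<le> M * 1"
    unfolding abs_mult using slope t by (intro mult_mono) auto
  moreover have "\<bar>RL_integral q h t\<bar> \<le> RL_integral q g 1"
    using RL[of q t] RL_integral_mono_endpoint[OF _ g g0, of q t 1] q t by simp
  ultimately have "\<bar>linear_solution h t\<bar> \<le>
      RL_integral q g 1 + (B + RL_integral q g 1 + M * \<bar>\<Delta>\<^sub>3\<bar> / 2) / \<bar>\<Delta>\<^sub>2\<bar> + M"
    using offset unfolding linear_solution_def by linarith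
  also have "\<dots> = linear_bound g"
    unfolding linear_bound_def M_def A_def[symmetric] B_def[symmetric] abs_mult
    using nonzero by (simp add: field_simps)
  finally show ?thesis .
qed

lemma linear_bound_cmult: "linear_bound (\<lambda>s. c * g s) = c * linear_bound g"
  unfolding linear_bound_def RL_integral_cmult
  by (simp add: algebra_simps sum_distrib_left)

lemma linear_bound_eq_integrals:
  assumes g: "continuous_on {0..1} g"
  shows "linear_bound g =
      (1 + 1 / \<bar>\<Delta>\<^sub>2\<bar>) * integral {0..1} (\<lambda>s. (1 - s) powr (q - 1) / Gamma q * g s)
      + 1 / \<bar>\<Delta>\<^sub>2\<bar> * (\<Sum>i=1..n. integral {0..\<eta> i}
          (\<lambda>s. (\<eta> i - s) powr (q - 1) / Gamma (q + 1) * (q * \<bar>\<gamma> i\<bar> + \<bar>\<beta> i\<bar> * (\<eta> i - s)) * g s))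
      + Gamma (2 - \<sigma>) * Gamma (2 - \<nu>) * (\<bar>\<Delta>\<^sub>3\<bar> + 2 * \<bar>\<Delta>\<^sub>2\<bar>) / (2 * \<bar>\<Delta>\<^sub>1 * \<Delta>\<^sub>2\<bar>)
        * (integral {0..\<xi>} (\<lambda>s. (\<xi> - s) powr (q - \<sigma> - 1) / Gamma (q - \<sigma>) * g s)
           + (\<Sum>i=1..n. \<bar>\<alpha> i\<bar> * integral {0..\<eta> i}
               (\<lambda>s. (\<eta> i - s) powr (q - \<nu> - 1) / Gamma (q - \<nu>) * g s)))"
proof -
  have RL: "integral {0..t} (\<lambda>s. (t - s) powr (a - 1) / Gamma a * g s) = RL_integral a g t"
    if "0 < a" for a t
  proof -
    have "integral {0..t} (\<lambda>s. 1 / Gamma a * ((t - s) powr (a - 1) * g s)) = RL_integral a g t"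
      using that by (simp add: RL_integral_def)
    then show ?thesis by simp
  qed
  have "integral {0..\<eta> i} (\<lambda>s. (\<eta> i - s) powr (q - 1) / Gamma (q + 1) * (q * \<bar>\<gamma> i\<bar> + \<bar>\<beta> i\<bar> * (\<eta> i - s)) * g s)
    = \<bar>\<gamma> i\<bar> * RL_integral q g (\<eta> i) + \<bar>\<beta> i\<bar> * RL_integral (q + 1) g (\<eta> i)" if i: "i \<in> {1..n}" for i
  proof -
    have "q \<notin> \<int>\<^sub>\<le>\<^sub>0" using q nonpos_Ints_nonpos[of q] by linarith
    then have G: "Gamma (q + 1) = q * Gamma q" "0 < Gamma q"
      using q Gamma_plus1[of q] by (auto intro: Gamma_real_pos)
    \<comment> \<open>Here \<open>G\<close> is \<open>Gamma q\<close> and \<open>d\<close> is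
      \<open>\<eta> i - s\<close>: the factor \<open>q\<close> cancels in the first term, and
      \<open>d\<close> raises the exponent of the kernel by one in the second.\<close>
    have split: "P / (q * G) * (q * a + b * d) * c = a / G * (P * c) + b / (q * G) * (P * d * c)"
      if "0 < G" for P G a b c d :: real
      using that q by (simp add: field_simps)
    have I: "(\<lambda>s. (\<eta> i - s) powr (a - 1) * g s) integrable_on {0..\<eta> i}" if "0 < a" for a
      using that \<eta>_01[OF i] by (intro RL_integrand_integrable continuous_on_subset_01[OF g]) auto
    have "integral {0..\<eta> i} (\<lambda>s. (\<eta> i - s) powr (q - 1) / Gamma (q + 1) * (q * \<bar>\<gamma> i\<bar> + \<bar>\<beta> i\<bar> * (\<eta> i - s)) * g s)
      = integral {0..\<eta> i} (\<lambda>s. \<bar>\<gamma> i\<bar> / Gamma q * ((\<eta> i - s) powr (q - 1) * g s)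
          + \<bar>\<beta> i\<bar> / Gamma (q + 1) * ((\<eta> i - s) powr (q + 1 - 1) * g s))"
    proof (rule integral_cong)
      fix s assume "s \<in> {0..\<eta> i}"
      then have p: "(\<eta> i - s) powr (q + 1 - 1) = (\<eta> i - s) powr (q - 1) * (\<eta> i - s)"
        using powr_mult_base[of "\<eta> i - s" "q - 1"] by (simp add: mult.commute)
      show "(\<eta> i - s) powr (q - 1) / Gamma (q + 1) * (q * \<bar>\<gamma> i\<bar> + \<bar>\<beta> i\<bar> * (\<eta> i - s)) * g s
        = \<bar>\<gamma> i\<bar> / Gamma q * ((\<eta> i - s) powr (q - 1) * g s)
          + \<bar>\<beta> i\<bar> / Gamma (q + 1) * ((\<eta> i - s) powr (q + 1 - 1) * g s)"
        unfolding p G(1) by (rule split[OF G(2)])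
    qed
    also have "\<dots> = \<bar>\<gamma> i\<bar> / Gamma q * integral {0..\<eta> i} (\<lambda>s. (\<eta> i - s) powr (q - 1) * g s)
          + \<bar>\<beta> i\<bar> / Gamma (q + 1) * integral {0..\<eta> i} (\<lambda>s. (\<eta> i - s) powr (q + 1 - 1) * g s)"
      by (subst integral_add[OF integrable_on_mult_right[OF I] integrable_on_mult_right[OF I]]) (use q in auto)
    also have "\<dots> = \<bar>\<gamma> i\<bar> * RL_integral q g (\<eta> i) + \<bar>\<beta> i\<bar> * RL_integral (q + 1) g (\<eta> i)"
      using q by (simp add: RL_integral_def)
    finally show ?thesis .
  qed
  moreover have "0 < q" "0 < q - \<sigma>" "0 < q - \<nu>" using q \<sigma> \<nu> by auto
  ultimately show ?thesis
    unfolding linear_bound_def by (simp only: RL cong: sum.cong)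
qed

end

lemma ln_1_plus_less: "0 < r \<Longrightarrow> ln (1 + r) < (r :: real)"
  using ln_le_minus_one[of "1 + r"] ln_eq_minus_one[of "1 + r"] by fastforce

theorem theorem3p4:
  fixes q \<sigma> \<nu> \<xi> \<Delta>\<^sub>1 \<Delta>\<^sub>2 \<Delta>\<^sub>3 \<Phi> :: real
    and n :: nat
    and \<eta> \<alpha> \<beta> \<gamma> :: "nat \<Rightarrow> real"
    and g :: "real \<Rightarrow> real"
    and f :: "real \<Rightarrow> real \<Rightarrow> real"
  assumes "1 < q" "q \<le> 2"
    and "0 < \<sigma>" "\<sigma> \<le> 1"
    and "0 < \<nu>" "\<nu> \<le> 1"
    and "1 \<le> n"
    and "0 < \<xi>" "\<xi> < \<eta> 1" "strict_mono_on {1..n} \<eta>" "\<eta> n < 1"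
    and "\<Delta>\<^sub>1 = \<xi> powr (1 - \<sigma>) * Gamma (2 - \<nu>)
               - Gamma (2 - \<sigma>) * (\<Sum>i=1..n. \<alpha> i * \<eta> i powr (1 - \<nu>))"
    and "\<Delta>\<^sub>2 = 1 - (\<Sum>i=1..n. \<beta> i * \<eta> i + \<gamma> i)"
    and "\<Delta>\<^sub>3 = - 2 + (\<Sum>i=1..n. \<eta> i * (\<beta> i * \<eta> i + 2 * \<gamma> i))"
    and "\<Delta>\<^sub>1 \<noteq> 0" "\<Delta>\<^sub>2 \<noteq> 0"
    and "continuous_on {0..1} g" "\<forall>t\<in>{0..1}. 0 \<le> g t"
    and "\<Phi> =
      (1 + 1 / \<bar>\<Delta>\<^sub>2\<bar>) * integral {0..1} (\<lambda>s. (1 - s) powr (q - 1) / Gamma q * g s)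
      + 1 / \<bar>\<Delta>\<^sub>2\<bar> * (\<Sum>i=1..n. integral {0..\<eta> i}
          (\<lambda>s. (\<eta> i - s) powr (q - 1) / Gamma (q + 1) * (q * \<bar>\<gamma> i\<bar> + \<bar>\<beta> i\<bar> * (\<eta> i - s)) * g s))
      + Gamma (2 - \<sigma>) * Gamma (2 - \<nu>) * (\<bar>\<Delta>\<^sub>3\<bar> + 2 * \<bar>\<Delta>\<^sub>2\<bar>) / (2 * \<bar>\<Delta>\<^sub>1 * \<Delta>\<^sub>2\<bar>)
        * (integral {0..\<xi>} (\<lambda>s. (\<xi> - s) powr (q - \<sigma> - 1) / Gamma (q - \<sigma>) * g s)
           + (\<Sum>i=1..n. \<bar>\<alpha> i\<bar> * integral {0..\<eta> i}
               (\<lambda>s. (\<eta> i - s) powr (q - \<nu> - 1) / Gamma (q - \<nu>) * g s)))"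
    and "0 < \<Phi>"
    and "continuous_on ({0..1} \<times> UNIV) (\<lambda>(t, x). f t x)"
    and "\<forall>t\<in>{0..1}. \<forall>x y. \<bar>f t x - f t y\<bar> \<le> g t * inverse \<Phi> * ln (1 + \<bar>x - y\<bar>)"
  shows "(\<exists>x. bvp_solution q \<sigma> \<nu> n \<xi> \<eta> \<alpha> \<beta> \<gamma> f x) \<and>
         (\<forall>x y. bvp_solution q \<sigma> \<nu> n \<xi> \<eta> \<alpha> \<beta> \<gamma> f x \<longrightarrow> bvp_solution q \<sigma> \<nu> n \<xi> \<eta> \<alpha> \<beta> \<gamma> f y \<longrightarrow>
            (\<forall>t\<in>{0..1}. x t = y t))"
proof -
  have \<eta>_mono: "\<eta> i \<le> \<eta> j" if "i \<in> {1..n}" "j \<in> {1..n}" "i \<le> j" for i j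
    using assms(10) that by (metis le_less order_refl strict_mono_onD)
  have \<eta>_pos: "0 < \<eta> i" and \<eta>_less: "\<eta> i < 1" if "i \<in> {1..n}" for i
    using \<eta>_mono[of 1 i] \<eta>_mono[of i n] that assms(8,9,11) by auto
  have \<xi>_less: "\<xi> < 1" using \<eta>_less[of 1] assms(7,9) by auto
  interpret fractional_bvp q \<sigma> \<nu> \<xi> n \<eta> \<alpha> \<beta> \<gamma> \<Delta>\<^sub>1 \<Delta>\<^sub>2 \<Delta>\<^sub>3
    by unfold_locales (use assms(1-6,8,12-16) \<xi>_less \<eta>_pos \<eta>_less in auto)
  have \<Phi>: "\<Phi> = linear_bound g"
    using linear_bound_eq_integrals[OF assms(17)] assms(19) by simp
  have cont_f: "continuous_on {0..1} (\<lambda>t. f t (x t))" if "continuous_on {0..1} x" for x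
  proof -
    have "continuous_on {0..1} (\<lambda>t. (\<lambda>(t, x). f t x) (t, x t))"
      using that by (intro continuous_on_compose2[OF assms(21)] continuous_intros) auto
    then show ?thesis by simp
  qed
  have contraction: "\<bar>linear_solution (\<lambda>t. f t (x t)) t - linear_solution (\<lambda>t. f t (y t)) t\<bar> \<le> ln (1 + D)"
    if x: "continuous_on {0..1} x" and y: "continuous_on {0..1} y"
      and D: "\<And>s. s \<in> {0..1} \<Longrightarrow> \<bar>x s - y s\<bar> \<le> D" and t: "t \<in> {0..1}" for x y D t
  proof -
    have "\<bar>f s (x s) - f s (y s)\<bar> \<le> ln (1 + D) / \<Phi> * g s" if s: "s \<in> {0..1}" for s
    proof -
      have "\<bar>f s (x s) - f s (y s)\<bar> \<le> g s * inverse \<Phi> * ln (1 + \<bar>x s - y s\<bar>)"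
        using assms(22) s by blast
      also have "\<dots> \<le> g s * inverse \<Phi> * ln (1 + D)"
        using assms(18,20) s D[OF s] by (intro mult_left_mono) (auto intro!: ln_mono)
      finally show ?thesis by (simp add: field_simps)
    qed
    then have "\<bar>linear_solution (\<lambda>t. f t (x t) - f t (y t)) t\<bar> \<le> linear_bound (\<lambda>s. ln (1 + D) / \<Phi> * g s)"
      using cont_f[OF x] cont_f[OF y] assms(17) t
      by (intro abs_linear_solution_le continuous_on_diff continuous_on_mult_left) auto
    \<comment> \<open>By homogeneity the bound is \<open>ln (1 + D) / \<Phi>\<close> times \<Phi>
      itself.\<close>
    also have "\<dots> = ln (1 + D)"
      unfolding linear_bound_cmult using assms(20) by (simp add: \<Phi>)
    finally show ?thesis
      using linear_solution_diff[OF cont_f[OF x] cont_f[OF y] t] by simp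
  qed
  have "\<exists>x. bvp_solution q \<sigma> \<nu> n \<xi> \<eta> \<alpha> \<beta> \<gamma> f x"
  proof -
    \<comment> \<open>The complete space is that of bounded continuous functions on the whole line.
      Clamping the argument by \<open>max 0 (min 1 t)\<close> extends the solution by its endpoint
      values, so it stays bounded and continuous and distances of images are controlled on the unit
      interval.\<close>
    define T :: "(real \<Rightarrow>\<^sub>C real) \<Rightarrow> (real \<Rightarrow>\<^sub>C real)" where
      "T X = Bcontfun (\<lambda>t. linear_solution (\<lambda>s. f s (apply_bcontfun X s)) (max 0 (min 1 t)))" for X
    have T: "apply_bcontfun (T X) t = linear_solution (\<lambda>s. f s (apply_bcontfun X s)) (max 0 (min 1 t))" for X t
    proof -
      let ?S = "linear_solution (\<lambda>s. f s (apply_bcontfun X s))"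
      have c: "continuous_on {0..1} ?S"
        by (intro continuous_on_linear_solution cont_f) simp
      then have "bounded (?S ` {0..1})"
        by (intro compact_imp_bounded compact_continuous_image) auto
      then have "bounded (range (\<lambda>t. ?S (max 0 (min 1 t))))"
        by (rule bounded_subset) auto
      moreover have "continuous_on UNIV (\<lambda>t. ?S (max 0 (min 1 t)))"
        by (intro continuous_on_compose2[OF c] continuous_intros) auto
      ultimately have "(\<lambda>t. ?S (max 0 (min 1 t))) \<in> bcontfun" by (simp add: bcontfun_def)
      then show ?thesis by (simp add: T_def Bcontfun_inverse)
    qed
    have "\<exists>X. T X = X"
    proof (rule comparison_contraction_fixed_point)
      show "dist (T X) (T Y) \<le> ln (1 + dist X Y)" for X Y
      proof (rule dist_bound)
        fix t :: real
        have "\<bar>apply_bcontfun X s - apply_bcontfun Y s\<bar> \<le> dist X Y" for s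
          using dist_bounded[of X s Y] by (simp add: dist_real_def)
        then show "dist (apply_bcontfun (T X) t) (apply_bcontfun (T Y) t) \<le> ln (1 + dist X Y)"
          unfolding T dist_real_def by (intro contraction) auto
      qed
    qed (auto intro!: mono_onI continuous_intros ln_1_plus_less)
    then obtain X where "T X = X" ..
    have "apply_bcontfun X t = linear_solution (\<lambda>s. f s (apply_bcontfun X s)) t" if "t \<in> {0..1}" for t
    proof -
      have "max 0 (min 1 t) = t" using that by auto
      with T[of X t] \<open>T X = X\<close> show ?thesis by metis
    qed
    then have "bvp_solution q \<sigma> \<nu> n \<xi> \<eta> \<alpha> \<beta> \<gamma> f (apply_bcontfun X)"
      by (subst bvp_solution_iff[of f "apply_bcontfun X", OF cont_f]) blast+
    then show ?thesis by blast
  qed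
  moreover have "x t = y t"
    if "bvp_solution q \<sigma> \<nu> n \<xi> \<eta> \<alpha> \<beta> \<gamma> f x" "bvp_solution q \<sigma> \<nu> n \<xi> \<eta> \<alpha> \<beta> \<gamma> f y"
      and t: "t \<in> {0..1}" for x y t
  proof -
    have c: "continuous_on {0..1} x" "continuous_on {0..1} y"
      using that by (auto simp: bvp_solution_def C1_01_continuous_on)
    \<comment> \<open>At a point where the difference is largest, the contraction estimate bounds
      that difference \<open>r\<close> by \<open>ln (1 + r)\<close>, which forces
      \<open>r = 0\<close>.\<close>
    then have "\<exists>m\<in>{0..1}. \<forall>s\<in>{0..1}. \<bar>x s - y s\<bar> \<le> \<bar>x m - y m\<bar>"
      by (intro continuous_attains_sup continuous_intros) auto
    then obtain m where m: "m \<in> {0..1}" "\<And>s. s \<in> {0..1} \<Longrightarrow> \<bar>x s - y s\<bar> \<le> \<bar>x m - y m\<bar>"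
      by blast
    have "x m = linear_solution (\<lambda>t. f t (x t)) m" "y m = linear_solution (\<lambda>t. f t (y t)) m"
      using bvp_solution_iff[of f, OF cont_f[OF c(1)]] bvp_solution_iff[of f, OF cont_f[OF c(2)]] that(1,2) m(1)
      by blast+
    with contraction[OF c m(2) m(1)] have "\<bar>x m - y m\<bar> \<le> ln (1 + \<bar>x m - y m\<bar>)"
      by metis
    then have "\<bar>x m - y m\<bar> = 0"
      using ln_1_plus_less[of "\<bar>x m - y m\<bar>"] by fastforce
    then show ?thesis using m(2)[OF t] by simp
  qed
  ultimately show ?thesis by blast
qed

end
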